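(* Let $X$, $Y$ be Banach spaces such that $X\hat{\otimes}_\varepsilon Y$ has the Daugavet property. Suppose that the norm of $Y$ is Fréchet differentiable at a point $y_0\in S_Y$. Then $X$ has the Daugavet property.
   Context: Banach spaces are real or complex; $X$ and $Y$ are over the same field. $S_X$, $B_X$ denote the unit sphere and closed unit ball of $X$, $X^*$ its topological dual, and $\mathcal{L}(X)$ the space of bounded linear operators on $X$ with the operator norm. A Banach space $X$ has the Daugavet property if $\|\mathrm{Id}+T\|=1+\|T\|$ for every rank-one operator $T\in\mathcal{L}(X)$. The injective tensor product $X\hat{\otimes}_\varepsilon Y$ is the completion of $X\otimes Y$ under $\|u\|_\varepsilon=\sup\{|\sum_{i=1}^n x^*(x_i)y^*(y_i)| : x^*\in B_{X^*},\ y^*\in B_{Y^*}\}$, where $\sum_{i=1}^n x_i\otimes y_i$ is any representation of $u$. *)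

theory Defs
  imports "HOL-Analysis.Analysis"
begin

text \<open>The scalar field is \<open>\<real>\<close> or \<open>\<complex>\<close> with its usual absolute value: the class axiom says that
  the field is either the image of the reals or has the form \<open>\<real> + \<real>j\<close> with \<open>j * j = - 1\<close>.\<close>

class real_or_complex = real_normed_field +
  assumes real_or_complex:
    "(\<forall>z. \<exists>a. z = a *\<^sub>R 1) \<or>
     (\<exists>j. j * j = - 1 \<and> (\<forall>z. \<exists>a b. z = a *\<^sub>R 1 + b *\<^sub>R j) \<and>
          (\<forall>a b. norm (a *\<^sub>R 1 + b *\<^sub>R j) = sqrt (a\<^sup>2 + b\<^sup>2)))"

instance real :: real_or_complex
  by standard simp

instance complex :: real_or_complex
proof
  have "\<i> * \<i> = - 1 \<and> (\<forall>z. \<exists>a b. z = a *\<^sub>R 1 + b *\<^sub>R \<i>) \<and>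
      (\<forall>a b. norm (a *\<^sub>R 1 + b *\<^sub>R \<i>) = sqrt (a\<^sup>2 + b\<^sup>2))"
    by (auto simp: complex_eq_iff cmod_def)
  then show "(\<forall>z::complex. \<exists>a. z = a *\<^sub>R 1) \<or>
     (\<exists>j::complex. j * j = - 1 \<and> (\<forall>z. \<exists>a b. z = a *\<^sub>R 1 + b *\<^sub>R j) \<and>
          (\<forall>a b. norm (a *\<^sub>R 1 + b *\<^sub>R j) = sqrt (a\<^sup>2 + b\<^sup>2)))"
    by blast
qed

text \<open>A Banach space over \<open>'k\<close>: class \<open>banach\<close> supplies the norm, its completeness and the
  multiplication by real numbers, which \<open>scale\<close> extends to \<open>'k\<close>.\<close>

locale banach_space = vector_space scale
  for scale :: "'k::real_or_complex \<Rightarrow> 'a::banach \<Rightarrow> 'a" +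
  assumes scale_of_real: "scale (of_real r) x = r *\<^sub>R x"
    and norm_scale: "norm (scale c x) = norm c * norm x"

definition bounded_operator ::
    "('k::real_or_complex \<Rightarrow> 'a::banach \<Rightarrow> 'a) \<Rightarrow> ('k \<Rightarrow> 'b::real_normed_vector \<Rightarrow> 'b) \<Rightarrow> ('a \<Rightarrow> 'b) \<Rightarrow> bool"
  where "bounded_operator s t T \<longleftrightarrow> Vector_Spaces.linear s t T \<and> bounded_linear T"

definition dual_ball :: "('k::real_or_complex \<Rightarrow> 'a::banach \<Rightarrow> 'a) \<Rightarrow> ('a \<Rightarrow> 'k) set"
  where "dual_ball s = {f. bounded_operator s (*) f \<and> onorm f \<le> 1}"

definition daugavet_property :: "('k::real_or_complex \<Rightarrow> 'a::banach \<Rightarrow> 'a) \<Rightarrow> bool"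
  where "daugavet_property s \<longleftrightarrow>
    (\<forall>T. bounded_operator s s T \<and> vector_space.dim s (range T) = 1
      \<longrightarrow> onorm (\<lambda>x. x + T x) = 1 + onorm T)"

definition bilinear_form ::
    "('k::real_or_complex \<Rightarrow> 'a::banach \<Rightarrow> 'a) \<Rightarrow> ('k \<Rightarrow> 'b::banach \<Rightarrow> 'b) \<Rightarrow> ('a \<Rightarrow> 'b \<Rightarrow> 'k) \<Rightarrow> bool"
  where "bilinear_form s t B \<longleftrightarrow>
    (\<forall>x. Vector_Spaces.linear t (*) (B x)) \<and> (\<forall>y. Vector_Spaces.linear s (*) (\<lambda>x. B x y))"

text \<open>The algebraic tensor product is realised in the usual way as a space of functionals on
  the bilinear forms, \<open>x \<otimes> y\<close> being evaluation at \<open>(x, y)\<close>; two finite sums of elementary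
  tensors are equal iff all bilinear forms agree on them.  Functionals are set to \<open>0\<close> at
  functions that are not bilinear.\<close>

type_synonym ('a, 'b, 'k) tensor = "('a \<Rightarrow> 'b \<Rightarrow> 'k) \<Rightarrow> 'k"

definition elem_tensor ::
    "('k::real_or_complex \<Rightarrow> 'a::banach \<Rightarrow> 'a) \<Rightarrow> ('k \<Rightarrow> 'b::banach \<Rightarrow> 'b) \<Rightarrow> 'a \<Rightarrow> 'b \<Rightarrow> ('a, 'b, 'k) tensor"
  where "elem_tensor s t x y = (\<lambda>B. if bilinear_form s t B then B x y else 0)"

definition tensor_product ::
    "('k::real_or_complex \<Rightarrow> 'a::banach \<Rightarrow> 'a) \<Rightarrow> ('k \<Rightarrow> 'b::banach \<Rightarrow> 'b) \<Rightarrow> ('a, 'b, 'k) tensor set"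
  where "tensor_product s t =
    {\<lambda>B. \<Sum>i<n. elem_tensor s t (x i) (y i) B | (n::nat) x y. True}"

text \<open>Evaluating a tensor at the bilinear form \<open>(x, y) \<mapsto> f x * g y\<close> gives the sum of the
  \<open>f (x i) * g (y i)\<close> for any of its representations (see \<open>injective_norm_sum\<close> below).\<close>

definition injective_norm ::
    "('k::real_or_complex \<Rightarrow> 'a::banach \<Rightarrow> 'a) \<Rightarrow> ('k \<Rightarrow> 'b::banach \<Rightarrow> 'b) \<Rightarrow> ('a, 'b, 'k) tensor \<Rightarrow> real"
  where "injective_norm s t u =
    (SUP (f, g) \<in> dual_ball s \<times> dual_ball t. norm (u (\<lambda>x y. f x * g y)))"

lemma bilinear_form_dual:
  assumes "f \<in> dual_ball s" "g \<in> dual_ball t"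
  shows "bilinear_form s t (\<lambda>x y. f x * g y)"
proof -
  have f: "Vector_Spaces.linear s (*) f" and g: "Vector_Spaces.linear t (*) g"
    using assms by (auto simp: dual_ball_def bounded_operator_def)
  interpret F: Vector_Spaces.linear s "(*)" f by (fact f)
  interpret G: Vector_Spaces.linear t "(*)" g by (fact g)
  show ?thesis
    unfolding bilinear_form_def
    by (intro conjI allI; unfold_locales)
       (simp_all add: F.add G.add F.scale G.scale algebra_simps)
qed

lemma injective_norm_sum:
  "injective_norm s t (\<lambda>B. \<Sum>i<n. elem_tensor s t (x i) (y i) B) =
    (SUP (f, g) \<in> dual_ball s \<times> dual_ball t. norm (\<Sum>i<n. f (x i) * g (y i)))"
  unfolding injective_norm_def
  by (rule SUP_cong) (auto simp: elem_tensor_def bilinear_form_dual)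

text \<open>The Banach space with scalar multiplication \<open>sZ\<close>, together with the embedding \<open>\<iota>\<close>, is a
  completion of the space \<open>V\<close> of \<open>'k\<close>-valued functions (with pointwise operations) under the
  norm \<open>N\<close>.  Such a completion is unique up to isometric isomorphism.\<close>

definition is_completion ::
    "('i \<Rightarrow> 'k::real_or_complex) set \<Rightarrow> (('i \<Rightarrow> 'k) \<Rightarrow> real) \<Rightarrow> ('k \<Rightarrow> 'z::banach \<Rightarrow> 'z) \<Rightarrow>
      (('i \<Rightarrow> 'k) \<Rightarrow> 'z) \<Rightarrow> bool"
  where "is_completion V N sZ \<iota> \<longleftrightarrow>
    banach_space sZ \<and>
    (\<forall>u\<in>V. \<forall>v\<in>V. \<iota> (\<lambda>i. u i + v i) = \<iota> u + \<iota> v) \<and>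
    (\<forall>c. \<forall>u\<in>V. \<iota> (\<lambda>i. c * u i) = sZ c (\<iota> u)) \<and>
    (\<forall>u\<in>V. norm (\<iota> u) = N u) \<and>
    closure (\<iota> ` V) = UNIV"

definition injective_tensor_product ::
    "('k::real_or_complex \<Rightarrow> 'a::banach \<Rightarrow> 'a) \<Rightarrow> ('k \<Rightarrow> 'b::banach \<Rightarrow> 'b) \<Rightarrow>
      ('k \<Rightarrow> 'z::banach \<Rightarrow> 'z) \<Rightarrow> (('a, 'b, 'k) tensor \<Rightarrow> 'z) \<Rightarrow> bool"
  where "injective_tensor_product sX sY sZ \<iota> \<longleftrightarrow>
    is_completion (tensor_product sX sY) (injective_norm sX sY) sZ \<iota>"

end

theory Submission
  imports Defs
begin

text \<open>
  Let \<open>T = f(\<cdot>) x0\<close> be a rank-one operator on \<open>X\<close>, normalised so that \<open>f\<close> is in the dual ball and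
  \<open>norm x0 = onorm T\<close>.  The derivative of the norm at \<open>y0\<close> is the real part of a functional \<open>g0\<close> in
  the dual ball of \<open>Y\<close> with \<open>g0 y0 = 1\<close>.  On the tensor product consider the rank-one operator
  \<open>S u = (f \<otimes> g0)(u) (x0 \<otimes> y0)\<close>; testing it on the tensors \<open>x \<otimes> y0\<close> gives \<open>onorm T \<le> onorm S\<close>, so the
  Daugavet property yields \<open>1 + onorm T \<le> onorm (id + S)\<close>.

  For an upper bound let \<open>u\<close> be a tensor of norm \<open>1\<close>.  The norm of \<open>w = u + S u\<close> is a supremum of values
  \<open>(h \<otimes> g)(w) = (h \<otimes> g)(u) + (f \<otimes> g0)(u) * h x0 * g y0\<close>.  Fix \<open>\<delta>\<close> and take the \<open>\<eta>\<close> that Smulyan's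
  lemma (\<open>smulyan\<close>) assigns to it.
  If \<open>norm (g y0) \<le> 1 - \<eta>\<close>, such a value has modulus at most \<open>1 + onorm T * (1 - \<eta>)\<close>;
  this lies strictly below \<open>1 + onorm T\<close>, so these \<open>g\<close> cannot account for the lower bound.
  Otherwise a unimodular multiple of \<open>g\<close> is \<open>\<delta>\<close>-close to \<open>g0\<close>, so that up to an error
  \<open>\<delta> * (1 + onorm T)\<close> the value is \<open>(h \<otimes> g0)(w) = h (x + T x)\<close>, where \<open>x = (id \<otimes> g0)(u)\<close> has norm at
  most \<open>1\<close> (\<open>tensor_slice\<close>); this is at most \<open>onorm (id + T)\<close>.  Hence
  \<open>1 + onorm T \<le> onorm (id + T) + \<delta> * (1 + onorm T)\<close> for every \<open>\<delta>\<close>.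

  Norms of vectors in \<open>X\<close> are recovered from the dual ball by the Hahn-Banach theorem, proved here
  through minimal sublinear functionals (\<open>hahn_banach_sublinear\<close>), and \<open>f \<otimes> g0\<close> reaches the completion
  by density (\<open>completion_extend_functional\<close>).
\<close>

section \<open>The real part of a scalar\<close>

text \<open>The real part, by polarisation: this formula makes sense without choosing an imaginary unit
  and so covers both scalar fields.\<close>

definition real_part :: "'k::real_or_complex \<Rightarrow> real"
  where "real_part z = ((norm (1 + z))\<^sup>2 - (norm (1 - z))\<^sup>2) / 4"

lemma real_part_of_real: "real_part (of_real r :: 'k::real_or_complex) = r"
proof -
  have "norm (1 + of_real r :: 'k) = \<bar>1 + r\<bar>" "norm (1 - of_real r :: 'k) = \<bar>1 - r\<bar>"
    by (metis norm_of_real of_real_1 of_real_add, metis norm_of_real of_real_1 of_real_diff)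
  then show ?thesis
    by (simp add: real_part_def power2_eq_square algebra_simps)
qed

text \<open>The two scalar fields are treated together by letting \<open>j\<close> be \<open>0\<close> over the reals and an
  imaginary unit over the complex numbers.  In both cases \<open>- real_part (j * z)\<close> is the
  coordinate of \<open>z\<close> along \<open>j\<close>.\<close>

lemma imaginary_unit_cases:
  obtains j :: "'k::real_or_complex"
  where "j = 0 \<or> j * j = - 1"
    and "\<And>a b. real_part (of_real a + of_real b * j) = a"
    and "\<And>z. z = of_real (real_part z) - of_real (real_part (j * z)) * j"
    and "\<And>z. (norm z)\<^sup>2 = (real_part z)\<^sup>2 + (real_part (j * z))\<^sup>2"
proof -
  consider (real) "\<forall>z::'k. \<exists>a. z = a *\<^sub>R 1"
    | (complex) j :: 'k where "j * j = - 1" "\<forall>z. \<exists>a b. z = a *\<^sub>R 1 + b *\<^sub>R j"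
        "\<forall>a b. norm (a *\<^sub>R 1 + b *\<^sub>R j) = sqrt (a\<^sup>2 + b\<^sup>2)"
    using real_or_complex by blast
  then show thesis
  proof cases
    case real
    show thesis
    proof (rule that[of 0])
      fix z :: 'k
      obtain a where a: "z = of_real a"
        using real by (auto simp: of_real_def)
      show "z = of_real (real_part z) - of_real (real_part (0 * z)) * 0"
        by (simp add: a real_part_of_real)
      show "(norm z)\<^sup>2 = (real_part z)\<^sup>2 + (real_part (0 * z))\<^sup>2"
        using real_part_of_real[of 0, where 'k = 'k] by (simp add: a real_part_of_real)
    qed (simp_all add: real_part_of_real)
  next
    case (complex j)
    have nrm: "(norm (of_real a + of_real b * j))\<^sup>2 = a\<^sup>2 + b\<^sup>2" for a b
      using complex(3)[rule_format, of a b] by (simp add: scaleR_conv_of_real)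
    have re: "real_part (of_real a + of_real b * j) = a" for a b
    proof -
      have "1 + (of_real a + of_real b * j) = of_real (1 + a) + of_real b * j"
        "1 - (of_real a + of_real b * j) = of_real (1 - a) + of_real (- b) * j"
        by simp_all
      then show ?thesis
        unfolding real_part_def by (simp only: nrm) (simp add: power2_eq_square algebra_simps)
    qed
    have im: "real_part (j * (of_real a + of_real b * j)) = - b" for a b
    proof -
      have "j * (of_real a + of_real b * j) = of_real a * j + of_real b * (j * j)"
        by (simp add: algebra_simps)
      also have "\<dots> = of_real (- b) + of_real a * j"
        by (simp add: complex(1))
      finally show ?thesis by (simp only: re)
    qed
    show thesis
    proof (rule that[of j])
      show "j = 0 \<or> j * j = - 1" using complex(1) by simp
      fix a b show "real_part (of_real a + of_real b * j) = a" by (fact re)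
    next
      fix z :: 'k
      obtain a b where z: "z = of_real a + of_real b * j"
        using complex(2)[rule_format, of z] by (auto simp: scaleR_conv_of_real)
      show "z = of_real (real_part z) - of_real (real_part (j * z)) * j"
        unfolding z re im by simp
      show "(norm z)\<^sup>2 = (real_part z)\<^sup>2 + (real_part (j * z))\<^sup>2"
        unfolding z re im nrm by simp
    qed
  qed
qed

lemma bounded_linear_real_part: "bounded_linear (real_part :: 'k::real_or_complex \<Rightarrow> real)"
proof -
  obtain j :: 'k where re: "\<And>a b. real_part (of_real a + of_real b * j) = a"
    and rep: "\<And>z. z = of_real (real_part z) - of_real (real_part (j * z)) * j"
    and nrm: "\<And>z. (norm z)\<^sup>2 = (real_part z)\<^sup>2 + (real_part (j * z))\<^sup>2"
    by (rule imaginary_unit_cases) blast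
  show ?thesis
  proof
    fix z w :: 'k and r :: real
    obtain a b c d where z: "z = of_real a + of_real b * j" and w: "w = of_real c + of_real d * j"
      using rep[of z] rep[of w] by (metis diff_conv_add_uminus mult_minus_left of_real_minus)
    have "z + w = of_real (a + c) + of_real (b + d) * j"
      by (simp add: z w algebra_simps)
    then show "real_part (z + w) = real_part z + real_part w"
      by (simp only: re z w)
    have "r *\<^sub>R z = of_real (r * a) + of_real (r * b) * j"
      by (simp add: z scaleR_conv_of_real algebra_simps)
    then show "real_part (r *\<^sub>R z) = r *\<^sub>R real_part z"
      by (simp only: re z real_scaleR_def)
  next
    have "norm (real_part z) \<le> norm z * 1" for z :: 'k
      using nrm[of z] by (simp add: abs_le_square_iff[of "real_part z" "norm z", simplified])
    then show "\<exists>K. \<forall>z::'k. norm (real_part z) \<le> norm z * K"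
      by blast
  qed
qed

lemma abs_real_part_le_norm: "\<bar>real_part z\<bar> \<le> norm (z :: 'k::real_or_complex)"
proof -
  obtain j :: 'k where "\<And>z. (norm z)\<^sup>2 = (real_part z)\<^sup>2 + (real_part (j * z))\<^sup>2"
    by (rule imaginary_unit_cases) blast
  from this[of z] show ?thesis
    by (simp add: abs_le_square_iff[of "real_part z" "norm z", simplified])
qed

text \<open>Equality in \<open>real_part z \<le> norm z\<close> leaves no room for an imaginary part.\<close>

lemma real_part_eq_norm_imp:
  fixes z :: "'k::real_or_complex"
  assumes "norm z \<le> r" "real_part z = r"
  shows "z = of_real r"
proof -
  obtain j :: 'k where 
        rep: "\<And>z. z = of_real (real_part z) - of_real (real_part (j * z)) * j"
    and nrm: "\<And>z. (norm z)\<^sup>2 = (real_part z)\<^sup>2 + (real_part (j * z))\<^sup>2"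
    by (rule imaginary_unit_cases) blast
  have "(norm z)\<^sup>2 \<le> r\<^sup>2"
    using assms(1) by (simp add: power_mono)
  then have "real_part (j * z) = 0"
    using nrm[of z] assms(2) by simp
  then show ?thesis
    using rep[of z] assms(2) by simp
qed

lemma unimodular_rotation:
  fixes z :: "'k::real_or_complex"
  obtains c :: 'k where "norm c = 1" "c * z = of_real (norm z)"
proof (cases "z = 0")
  case True
  then show thesis by (intro that[of 1]) simp_all
next
  case False
  then show thesis
    by (intro that[of "of_real (norm z) / z"]) (simp_all add: norm_divide)
qed

text \<open>Completeness is needed to extend scalar-valued functionals from a dense subspace.\<close>

instance real_or_complex \<subseteq> banach
proof
  fix X :: "nat \<Rightarrow> 'a" assume X: "Cauchy X"
  obtain j :: 'a where rep: "\<And>z. z = of_real (real_part z) - of_real (real_part (j * z)) * j"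
    by (rule imaginary_unit_cases) blast
  have "convergent (\<lambda>n. real_part (X n))"
    using bounded_linear.Cauchy[OF bounded_linear_real_part X] by (simp add: Cauchy_convergent)
  then obtain a where a: "(\<lambda>n. real_part (X n)) \<longlonglongrightarrow> a"
    by (auto simp: convergent_def)
  have "bounded_linear (\<lambda>z. real_part (j * z))"
    by (rule bounded_linear_compose[OF bounded_linear_real_part bounded_linear_mult_right])
  from bounded_linear.Cauchy[OF this X] have "convergent (\<lambda>n. real_part (j * X n))"
    by (simp add: Cauchy_convergent)
  then obtain b where b: "(\<lambda>n. real_part (j * X n)) \<longlonglongrightarrow> b"
    by (auto simp: convergent_def)
  have "(\<lambda>n. of_real (real_part (X n)) - of_real (real_part (j * X n)) * j)
      \<longlonglongrightarrow> of_real a - of_real b * j"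
    by (intro tendsto_intros a b)
  then show "convergent X"
    using rep by (auto simp: convergent_def)
qed

section \<open>Dominated linear functionals\<close>

definition sublinear :: "('a::real_vector \<Rightarrow> real) \<Rightarrow> bool"
  where "sublinear p \<longleftrightarrow>
    (\<forall>x y. p (x + y) \<le> p x + p y) \<and> (\<forall>x r. 0 < r \<longrightarrow> p (r *\<^sub>R x) \<le> r * p x)"

lemma sublinear_add: "sublinear p \<Longrightarrow> p (x + y) \<le> p x + p y"
  and sublinear_scale_le: "sublinear p \<Longrightarrow> 0 < r \<Longrightarrow> p (r *\<^sub>R x) \<le> r * p x"
  by (simp_all add: sublinear_def)

lemma sublinear_zero: 
  assumes "sublinear p"
  shows "p 0 = 0"
  using sublinear_scale_le[OF assms, of 2 0] sublinear_scale_le[OF assms, of "1/2" 0] by simp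

lemma sublinear_scale:
  assumes "sublinear p" "0 \<le> r"
  shows "p (r *\<^sub>R x) = r * p x"
proof (cases "r = 0")
  case False
  then have r: "0 < r" using assms by simp
  have "p (inverse r *\<^sub>R (r *\<^sub>R x)) \<le> inverse r * p (r *\<^sub>R x)"
    using r by (intro sublinear_scale_le assms) simp
  then have "r * p x \<le> p (r *\<^sub>R x)"
    using r by (simp add: field_simps)
  then show ?thesis
    using sublinear_scale_le[OF assms(1) r, of x] by simp
qed (simp add: sublinear_zero[OF assms(1)])

lemma sublinear_neg: "sublinear p \<Longrightarrow> - p (- x) \<le> p x"
  using sublinear_add[of p x "- x"] sublinear_zero[of p] by simp

text \<open>This criterion covers the two infima below: one over a chain of sublinear functionals, and one
  over functions \<open>x \<mapsto> p (x + t y) - t * p y\<close>, which are not sublinear individually.\<close>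

lemma sublinear_INF:
  assumes "I \<noteq> {}" and bdd: "\<And>x. bdd_below ((\<lambda>i. h i x) ` I)"
    and add: "\<And>i k x y. i \<in> I \<Longrightarrow> k \<in> I \<Longrightarrow> \<exists>l\<in>I. h l (x + y) \<le> h i x + h k y"
    and scale: "\<And>i x r. i \<in> I \<Longrightarrow> 0 < r \<Longrightarrow> \<exists>l\<in>I. h l (r *\<^sub>R x) \<le> r * h i x"
  shows "sublinear (\<lambda>x. INF i\<in>I. h i x)"
  unfolding sublinear_def
proof (intro conjI allI impI)
  fix x y
  have "(INF i\<in>I. h i (x + y)) - h k y \<le> (INF i\<in>I. h i x)" if "k \<in> I" for k
  proof (rule cINF_greatest[OF assms(1)])
    fix i assume "i \<in> I"
    then obtain l where "l \<in> I" "h l (x + y) \<le> h i x + h k y"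
      using add[OF \<open>i \<in> I\<close> \<open>k \<in> I\<close>, of x y] by metis
    with cINF_lower[OF bdd \<open>l \<in> I\<close>, of "x + y"]
    show "(INF i\<in>I. h i (x + y)) - h k y \<le> h i x" by simp
  qed
  then have "(INF i\<in>I. h i (x + y)) - (INF i\<in>I. h i x) \<le> (INF k\<in>I. h k y)"
    by (intro cINF_greatest[OF assms(1)]) (simp add: algebra_simps)
  then show "(INF i\<in>I. h i (x + y)) \<le> (INF i\<in>I. h i x) + (INF i\<in>I. h i y)"
    by simp
next
  fix x and r :: real assume r: "0 < r"
  have "(INF i\<in>I. h i (r *\<^sub>R x)) / r \<le> (INF i\<in>I. h i x)"
  proof (rule cINF_greatest[OF assms(1)])
    fix i assume "i \<in> I"
    then obtain l where "l \<in> I" "h l (r *\<^sub>R x) \<le> r * h i x"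
      using scale[OF \<open>i \<in> I\<close> r, of x] by metis
    with cINF_lower[OF bdd \<open>l \<in> I\<close>, of "r *\<^sub>R x"] r
    show "(INF i\<in>I. h i (r *\<^sub>R x)) / r \<le> h i x" by (simp add: field_simps)
  qed
  then show "(INF i\<in>I. h i (r *\<^sub>R x)) \<le> r * (INF i\<in>I. h i x)"
    using r by (simp add: field_simps)
qed

text \<open>The functional \<open>q x = (INF t\<ge>0. p (x + t y) - t * p y)\<close> lies below \<open>p\<close> and, taking \<open>t = 1\<close>
  at \<open>- y\<close>, satisfies \<open>q (- y) \<le> - p y\<close>.  This one step serves twice: it forces minimal
  sublinear functionals to be odd, and, applied to the norm, it makes every linear functional
  below \<open>q\<close> attain its norm at \<open>y\<close>.\<close>

lemma sublinear_decrease: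
  assumes p: "sublinear p"
  obtains q where "sublinear q" "\<And>x. q x \<le> p x" "q (- y) \<le> - p y"
proof -
  define h where "h t x = p (x + t *\<^sub>R y) - t * p y" for t x
  let ?I = "{0::real..}"
  have bdd: "bdd_below ((\<lambda>t. h t x) ` ?I)" for x
  proof (rule bdd_belowI2)
    fix t :: real assume "t \<in> ?I"
    then have "t * p y = p (t *\<^sub>R y)" using sublinear_scale[OF p] by simp
    also have "\<dots> \<le> p (x + t *\<^sub>R y) + p (- x)"
      using sublinear_add[OF p, of "x + t *\<^sub>R y" "- x"] by simp
    finally show "- p (- x) \<le> h t x" by (simp add: h_def)
  qed
  have sub: "sublinear (\<lambda>x. INF t\<in>?I. h t x)"
  proof (rule sublinear_INF[OF _ bdd])
    fix t s x z assume ts: "t \<in> ?I" "s \<in> ?I"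
    have "p (x + z + (t + s) *\<^sub>R y) \<le> p (x + t *\<^sub>R y) + p (z + s *\<^sub>R y)"
      using sublinear_add[OF p, of "x + t *\<^sub>R y" "z + s *\<^sub>R y"] by (simp add: algebra_simps)
    then have "h (t + s) (x + z) \<le> h t x + h s z"
      by (simp add: h_def algebra_simps)
    then show "\<exists>l\<in>?I. h l (x + z) \<le> h t x + h s z"
      using ts by (intro bexI[of _ "t + s"]) auto
  next
    fix t x and r :: real assume t: "t \<in> ?I" and r: "0 < r"
    have "p (r *\<^sub>R (x + t *\<^sub>R y)) \<le> r * p (x + t *\<^sub>R y)"
      by (rule sublinear_scale_le[OF p r])
    then have "h (r * t) (r *\<^sub>R x) \<le> r * h t x"
      by (simp add: h_def algebra_simps)
    then show "\<exists>l\<in>?I. h l (r *\<^sub>R x) \<le> r * h t x"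
      using t r by (intro bexI[of _ "r * t"]) auto
  qed simp
  have le: "(INF t\<in>?I. h t x) \<le> p x" for x
    using cINF_lower[OF bdd, of 0 x] by (simp add: h_def)
  have "(INF t\<in>?I. h t (- y)) \<le> - p y"
    using cINF_lower[OF bdd, of 1 "- y"] by (simp add: h_def sublinear_zero[OF p])
  with sub le show thesis by (rule that)
qed

text \<open>By minimality the decreased functional is \<open>p\<close> itself, so \<open>p (- y) = - p y\<close>; a subadditive odd
  function is additive.\<close>

lemma minimal_sublinear_linear:
  assumes p: "sublinear p" and min: "\<And>q. sublinear q \<Longrightarrow> (\<And>x. q x \<le> p x) \<Longrightarrow> q = p"
  shows "linear p"
proof -
  have neg: "p (- y) = - p y" for y
  proof -
    obtain q where q: "sublinear q" "\<And>x. q x \<le> p x" "q (- y) \<le> - p y"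
      using sublinear_decrease[OF p, of y] by metis
    have "q = p" by (rule min[OF q(1,2)])
    with q(3) have "p (- y) \<le> - p y" by simp
    then show ?thesis using sublinear_neg[OF p, of y] by simp
  qed
  show ?thesis
  proof
    fix x y
    have "p (x + y) - p y \<le> p x"
      using sublinear_add[OF p, of x y] by simp
    moreover have "p x \<le> p (x + y) - p y"
      using sublinear_add[OF p, of "x + y" "- y"] by (simp add: neg)
    ultimately show "p (x + y) = p x + p y" by simp
  next
    fix r x
    show "p (r *\<^sub>R x) = r *\<^sub>R p x"
    proof (cases "0 \<le> r")
      case False
      then have "p ((- r) *\<^sub>R x) = (- r) * p x"
        by (intro sublinear_scale[OF p]) simp
      then show ?thesis by (simp add: neg)
    qed (simp add: sublinear_scale[OF p])
  qed
qed

text \<open>The Hahn-Banach theorem in the form of dominated linear functionals.  Zorn's lemma gives a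
  minimal sublinear functional below \<open>p\<close>: the infimum of a chain is finite since
  \<open>q x \<ge> - q (- x) \<ge> - p (- x)\<close>, and is sublinear since two members of a chain are dominated by
  the smaller one.\<close>

lemma hahn_banach_sublinear:
  assumes p: "sublinear p"
  obtains l where "linear l" "\<And>x. l x \<le> p x"
proof -
  define A where "A = {q. sublinear q \<and> (\<forall>x. q x \<le> p x)}"
  define P where "P q r \<longleftrightarrow> (\<forall>x. r x \<le> q x)" for q r :: "'a \<Rightarrow> real"
  have "\<exists>m\<in>A. \<forall>a\<in>A. P m a \<longrightarrow> a = m"
  proof (rule predicate_Zorn)
    show "partial_order_on A (relation_of P A)"
    proof (rule partial_order_on_relation_ofI)
      show "P a a" for a by (simp add: P_def)
      show "P a c" if "P a b" "P b c" for a b c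
        using that unfolding P_def by (meson order_trans)
      show "a = b" if "P a b" "P b a" for a b
        using that unfolding P_def by (intro ext antisym) blast+
    qed
  next
    fix C assume C: "C \<in> Chains (relation_of P A)"
    show "\<exists>u\<in>A. \<forall>a\<in>C. P a u"
    proof (cases "C = {}")
      case True
      then show ?thesis using p by (auto simp: A_def)
    next
      case False
      have CA: "q \<in> A" if "q \<in> C" for q
        using C that by (auto simp: Chains_def relation_of_def)
      have bdd: "bdd_below ((\<lambda>q. q x) ` C)" for x
      proof (rule bdd_belowI2)
        fix q assume "q \<in> C"
        then have "sublinear q" "q (- x) \<le> p (- x)"
          using CA by (auto simp: A_def)
        then show "- p (- x) \<le> q x"
          using sublinear_neg[of q x] by simp
      qed
      have sub: "sublinear (\<lambda>x. INF q\<in>C. q x)"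
      proof (rule sublinear_INF[OF False bdd])
        fix q r x y assume qr: "q \<in> C" "r \<in> C"
        then have sub: "sublinear q" "sublinear r" using CA by (auto simp: A_def)
        consider "\<forall>x. q x \<le> r x" | "\<forall>x. r x \<le> q x"
          using C qr by (auto simp: Chains_def relation_of_def P_def)
        then show "\<exists>l\<in>C. l (x + y) \<le> q x + r y"
        proof cases
          case 1
          then show ?thesis
            using sublinear_add[OF sub(1), of x y] qr by (intro bexI[of _ q]) (auto intro: order_trans)
        next
          case 2
          then show ?thesis
            using sublinear_add[OF sub(2), of x y] qr by (intro bexI[of _ r]) (auto intro: order_trans)
        qed
      next
        fix q x and r :: real assume "q \<in> C" "0 < r"
        then show "\<exists>l\<in>C. l (r *\<^sub>R x) \<le> r * q x"
          using CA by (auto simp: A_def intro!: bexI[of _ q] sublinear_scale_le)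
      qed
      have le: "(INF q\<in>C. q x) \<le> q x" if "q \<in> C" for q x
        by (rule cINF_lower[OF bdd that])
      obtain q where "q \<in> C" using False by blast
      then have "(INF q\<in>C. q x) \<le> p x" for x
        using le[of q x] CA[of q] by (auto simp: A_def intro: order_trans)
      with sub le show ?thesis
        by (intro bexI[of _ "\<lambda>x. INF q\<in>C. q x"]) (auto simp: A_def P_def)
    qed
  qed
  then obtain m where m: "m \<in> A" "\<And>a. a \<in> A \<Longrightarrow> P m a \<Longrightarrow> a = m" by blast
  have "linear m"
  proof (rule minimal_sublinear_linear)
    fix q assume "sublinear q" "\<And>x. q x \<le> m x"
    then show "q = m"
      using m(1) by (intro m(2)) (auto simp: A_def P_def intro: order_trans)
  qed (use m in \<open>simp add: A_def\<close>)
  then show thesis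
    using m by (intro that[of m]) (auto simp: A_def)
qed

lemma real_norming_functional:
  fixes x0 :: "'a::real_normed_vector"
  obtains l where "linear l" "\<And>x. l x \<le> norm x" "l x0 = norm x0"
proof -
  have norm: "sublinear (norm :: 'a \<Rightarrow> real)"
    by (simp add: sublinear_def norm_triangle_ineq)
  obtain q where q: "sublinear q" "\<And>x. q x \<le> norm x" "q (- x0) \<le> - norm x0"
    using sublinear_decrease[OF norm, of x0] by metis
  obtain l where l: "linear l" "\<And>x. l x \<le> q x"
    using hahn_banach_sublinear[OF q(1)] by metis
  have "- l x0 \<le> - norm x0"
    using l(2)[of "- x0"] q(3) by (simp add: linear_neg[OF l(1)])
  moreover have "l x \<le> norm x" for x
    using l(2) q(2) order_trans by blast
  ultimately show thesis
    using l(1) by (intro that[of l]) (auto intro: antisym)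
qed

section \<open>The dual ball\<close>

lemma banach_space_scalars: "banach_space ((*) :: 'k::real_or_complex \<Rightarrow> 'k \<Rightarrow> 'k)"
  by unfold_locales (simp_all add: scaleR_conv_of_real norm_mult algebra_simps)

context banach_space
begin

lemma bounded_linear_scale: "bounded_linear (scale c)"
proof
  fix x y and r :: real
  show "scale c (x + y) = scale c x + scale c y" by (rule scale_right_distrib)
  show "scale c (r *\<^sub>R x) = r *\<^sub>R scale c x"
    by (metis scale_of_real scale_left_commute)
  show "\<exists>K. \<forall>x. norm (scale c x) \<le> norm x * K"
    by (intro exI[of _ "norm c"]) (simp add: norm_scale mult.commute)
qed

end

lemma bounded_operatorI:
  assumes "banach_space s" "banach_space t"
    and add: "\<And>x y. T (x + y) = T x + T y" and scale: "\<And>c x. T (s c x) = t c (T x)"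
    and bound: "\<And>x. norm (T x) \<le> K * norm x"
  shows "bounded_operator s t T"
proof -
  interpret S: banach_space s by fact
  interpret T: banach_space t by fact
  have "Vector_Spaces.linear s t T"
    by unfold_locales (simp_all add: add scale)
  moreover have "bounded_linear T"
  proof
    fix x y r
    show "T (x + y) = T x + T y" by (rule add)
    show "T (r *\<^sub>R x) = r *\<^sub>R T x"
      by (metis scale S.scale_of_real T.scale_of_real)
    show "\<exists>K. \<forall>x. norm (T x) \<le> norm x * K"
      using bound by (auto simp: mult.commute)
  qed
  ultimately show ?thesis by (simp add: bounded_operator_def)
qed

lemma dual_ballI:
  assumes "banach_space s"
    and "\<And>x y. f (x + y) = f x + f y" and "\<And>c x. f (s c x) = c * f x"
    and "\<And>x. norm (f x) \<le> norm x"
  shows "f \<in> dual_ball s"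
proof -
  have "bounded_operator s (*) f"
    by (rule bounded_operatorI[where K = 1]) (use assms banach_space_scalars in auto)
  moreover have "onorm f \<le> 1"
    using assms(4) by (intro onorm_bound) auto
  ultimately show ?thesis by (simp add: dual_ball_def)
qed

lemma dual_ball_add: "f \<in> dual_ball s \<Longrightarrow> f (x + y) = f x + f y"
  and dual_ball_scale: "f \<in> dual_ball s \<Longrightarrow> f (s c x) = c * f x"
  by (auto simp: dual_ball_def bounded_operator_def Vector_Spaces.linear_iff)

lemma dual_ball_scaleR: "f \<in> dual_ball s \<Longrightarrow> f (r *\<^sub>R x) = of_real r * f x"
  by (auto simp: dual_ball_def bounded_operator_def scaleR_conv_of_real linear_simps)

lemma dual_ball_zero_point: "f \<in> dual_ball s \<Longrightarrow> f 0 = 0"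
  by (auto simp: dual_ball_def bounded_operator_def linear_simps)

lemma dual_ball_sum: "f \<in> dual_ball s \<Longrightarrow> f (sum h A) = (\<Sum>i\<in>A. f (h i))"
  by (auto simp: dual_ball_def bounded_operator_def linear_sum bounded_linear.linear)

lemma dual_ball_norm: 
  assumes "f \<in> dual_ball s"
  shows "norm (f x) \<le> norm x"
proof -
  have f: "bounded_linear f" "onorm f \<le> 1"
    using assms by (auto simp: dual_ball_def bounded_operator_def)
  have "norm (f x) \<le> onorm f * norm x" by (rule onorm[OF f(1)])
  also have "\<dots> \<le> 1 * norm x" by (intro mult_right_mono f) simp
  finally show ?thesis by simp
qed

text \<open>The usual passage from a real functional \<open>D\<close> to \<open>x \<mapsto> D x - j * D (j x)\<close>, whose real part is \<open>D\<close>.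
  Rotating the value onto the positive axis shows that the norm does not grow.\<close>

lemma dual_ball_of_real_functional:
  fixes s :: "'k::real_or_complex \<Rightarrow> 'a::banach \<Rightarrow> 'a"
  assumes "banach_space s" and D: "linear D" "\<And>x. D x \<le> norm x"
  obtains g where "g \<in> dual_ball s" "\<And>x. real_part (g x) = D x"
    "\<And>x. D x = norm x \<Longrightarrow> g x = of_real (norm x)"
proof -
  interpret S: banach_space s by fact
  obtain j :: 'k where j: "j = 0 \<or> j * j = - 1"
    and re: "\<And>a b. real_part (of_real a + of_real b * j) = a"
    and rep: "\<And>z. z = of_real (real_part z) - of_real (real_part (j * z)) * j"
    by (rule imaginary_unit_cases) blast
  define g where "g x = of_real (D x) - of_real (D (s j x)) * j" for x
  have re_g: "real_part (g x) = D x" for x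
    using re[of "D x" "- D (s j x)"] by (simp add: g_def)
  have add: "g (x + y) = g x + g y" for x y
    by (simp add: g_def S.scale_right_distrib linear_add[OF D(1)] algebra_simps)
  have scale: "g (s c x) = c * g x" for c x
  proof -
    define a b where "a = real_part c" and "b = real_part (j * c)"
    have c: "c = of_real a - of_real b * j" unfolding a_def b_def by (rule rep)
    have "s c x = a *\<^sub>R x - b *\<^sub>R s j x"
      unfolding c by (simp add: S.scale_left_diff_distrib S.scale_of_real flip: S.scale_scale)
    then have 1: "D (s c x) = a * D x - b * D (s j x)"
      by (simp add: linear_diff[OF D(1)] linear_scale[OF D(1)])
    have "s j (s c x) = s (of_real a) (s j x) - s (of_real b) (s (j * j) x)"
      unfolding c by (simp add: S.scale_left_diff_distrib S.scale_right_diff_distrib ac_simps)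
    then have 2: "D (s j (s c x)) = a * D (s j x) - b * D (s (j * j) x)"
      by (simp only: S.scale_of_real linear_diff[OF D(1)] linear_scale[OF D(1)] real_scaleR_def)
    from j show ?thesis
    proof
      assume "j = 0"
      then show ?thesis
        by (simp add: g_def c S.scale_of_real linear_0[OF D(1)] linear_scale[OF D(1)])
    next
      assume jj: "j * j = - 1"
      have "c * g x = of_real a * of_real (D x) + of_real b * of_real (D (s j x)) * (j * j)
          - (of_real a * of_real (D (s j x)) + of_real b * of_real (D x)) * j"
        by (simp add: c g_def algebra_simps)
      moreover have "g (s c x) = of_real a * of_real (D x) - of_real b * of_real (D (s j x))
          - (of_real a * of_real (D (s j x)) + of_real b * of_real (D x)) * j"
        unfolding g_def 1 2 jj by (simp add: linear_neg[OF D(1)])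
      ultimately show ?thesis by (simp add: jj)
    qed
  qed
  have bound: "norm (g x) \<le> norm x" for x
  proof -
    obtain c where c: "norm c = 1" "c * g x = of_real (norm (g x))"
      by (rule unimodular_rotation)
    have "norm (g x) = real_part (g (s c x))"
      by (simp add: scale c real_part_of_real)
    also have "\<dots> \<le> norm (s c x)"
      by (simp add: re_g D)
    finally show ?thesis by (simp add: S.norm_scale c)
  qed
  have "g \<in> dual_ball s"
    by (rule dual_ballI[OF assms(1) add scale bound])
  moreover have "g x = of_real (norm x)" if "D x = norm x" for x
    by (rule real_part_eq_norm_imp[OF bound]) (simp add: re_g that)
  ultimately show thesis using re_g that by blast
qed

lemma norming_functional:
  assumes "banach_space s"
  obtains f where "f \<in> dual_ball s" "f x = of_real (norm x)"
proof -
  obtain l where l: "linear l" "\<And>z. l z \<le> norm z" "l x = norm x"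
    using real_norming_functional[of x] by metis
  obtain f where "f \<in> dual_ball s" "\<And>x. l x = norm x \<Longrightarrow> f x = of_real (norm x)"
    using dual_ball_of_real_functional[OF assms l(1,2)] by metis
  with l(3) show thesis using that by blast
qed

section \<open>Frechet differentiability of the norm\<close>

text \<open>Smulyan's lemma: at a point where the norm is Frechet differentiable, the elements of the dual
  ball that almost attain the norm there are, up to a unimodular factor, uniformly close to the
  derivative.  If the real part of \<open>g y0\<close> exceeds \<open>1 - \<eta>\<close>, then
  \<open>g (y0 + h) \<le> norm (y0 + h) \<le> 1 + D h + e * norm h\<close> bounds \<open>g h - D h\<close> by
  \<open>\<eta> + e * norm h\<close> in real parts; with \<open>norm h = r\<close> fixed and \<open>\<eta> = e * r\<close> this is an estimate
  relative to \<open>norm h\<close>, hence one for the norm of \<open>g - g0\<close>.\<close>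

lemma smulyan:
  fixes t :: "'k::real_or_complex \<Rightarrow> 'b::banach \<Rightarrow> 'b"
  assumes "banach_space t" and y0: "norm y0 = 1"
    and diff: "(norm :: 'b \<Rightarrow> real) differentiable (at y0)"
  obtains g0 where "g0 \<in> dual_ball t" "g0 y0 = 1"
    "\<And>\<delta>. 0 < \<delta> \<Longrightarrow> \<exists>\<eta>>0. \<forall>g\<in>dual_ball t. 1 - \<eta> < norm (g y0) \<longrightarrow>
        (\<exists>c. norm c = 1 \<and> (\<forall>y. norm (c * g y - g0 y) \<le> \<delta> * norm y))"
proof -
  interpret S: banach_space t by fact
  obtain D where "(norm has_derivative D) (at y0)"
    using diff by (auto simp: differentiable_def)
  then have blD: "bounded_linear D"
    and near: "\<And>e. 0 < e \<Longrightarrow> \<exists>d>0. \<forall>y. norm (y - y0) < d \<longrightarrow>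
      \<bar>norm y - norm y0 - D (y - y0)\<bar> \<le> e * norm (y - y0)"
    by (auto simp: has_derivative_at_alt)
  have D: "linear D" using blD by (rule bounded_linear.linear)
  have approx: "\<exists>d>0. \<forall>h. norm h < d \<longrightarrow> \<bar>norm (y0 + h) - 1 - D h\<bar> \<le> e * norm h"
    if e: "0 < e" for e
  proof -
    obtain d where "0 < d" and d: "\<And>y. norm (y - y0) < d \<Longrightarrow>
      \<bar>norm y - norm y0 - D (y - y0)\<bar> \<le> e * norm (y - y0)"
      using near[OF e] by blast
    have "\<bar>norm (y0 + h) - 1 - D h\<bar> \<le> e * norm h" if "norm h < d" for h
      using d[of "y0 + h"] that y0 by simp
    with \<open>0 < d\<close> show ?thesis by blast
  qed
  have D_le: "D h \<le> norm h" for h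
  proof (rule field_le_epsilon)
    fix e :: real assume e: "0 < e"
    define e' where "e' = e / (norm h + 1)"
    have pos: "0 < norm h + 1" by (simp add: add_nonneg_pos)
    have e': "0 < e'" "e' * norm h \<le> e" using e pos by (simp_all add: e'_def field_simps)
    obtain d where d: "0 < d" "\<And>h. norm h < d \<Longrightarrow> \<bar>norm (y0 + h) - 1 - D h\<bar> \<le> e' * norm h"
      using approx[OF e'(1)] by blast
    define r where "r = d / (norm h + 1)"
    have r: "0 < r" "norm (r *\<^sub>R h) < d"
      using d(1) pos by (simp_all add: r_def field_simps)
    have "r * D h \<le> norm (y0 + r *\<^sub>R h) - 1 + e' * norm (r *\<^sub>R h)"
      using d(2)[OF r(2)] by (simp add: linear_scale[OF D])
    also have "\<dots> \<le> r * norm h + e' * (r * norm h)"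
      using norm_triangle_ineq[of y0 "r *\<^sub>R h"] y0 r(1) by simp
    also have "\<dots> = r * (norm h + e' * norm h)"
      by (simp add: algebra_simps)
    finally have "D h \<le> norm h + e' * norm h"
      using r(1) by simp
    then show "D h \<le> norm h + e" using e'(2) by simp
  qed
  \<comment> \<open>Along the ray through \<open>y0\<close> the norm grows with slope \<open>1\<close>.\<close>
  have "1 \<le> D y0"
  proof (rule field_le_epsilon)
    fix e :: real assume e: "0 < e"
    obtain d where d: "0 < d" "\<And>h. norm h < d \<Longrightarrow> \<bar>norm (y0 + h) - 1 - D h\<bar> \<le> e * norm h"
      using approx[OF e] by blast
    define r where "r = d / 2"
    have r: "0 < r" "norm (r *\<^sub>R y0) < d"
      using d(1) y0 by (simp_all add: r_def)
    have "norm (y0 + r *\<^sub>R y0) = 1 + r"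
      using r(1) y0 by (simp flip: scaleR_left_distrib[of 1 r y0, simplified])
    then have "r \<le> r * (D y0 + e)"
      using d(2)[OF r(2)] r(1) y0 by (simp add: linear_scale[OF D] algebra_simps)
    then show "1 \<le> D y0 + e" using r(1) by simp
  qed
  then have D_y0: "D y0 = norm y0" using D_le[of y0] y0 by simp
  obtain g0 where g0: "g0 \<in> dual_ball t" "\<And>x. real_part (g0 x) = D x"
    "\<And>x. D x = norm x \<Longrightarrow> g0 x = of_real (norm x)"
    using dual_ball_of_real_functional[OF assms(1) D D_le] by metis
  have g0_y0: "g0 y0 = 1" using g0(3)[OF D_y0] y0 by simp
  have "\<exists>\<eta>>0. \<forall>g\<in>dual_ball t. 1 - \<eta> < norm (g y0) \<longrightarrow>
        (\<exists>c. norm c = 1 \<and> (\<forall>y. norm (c * g y - g0 y) \<le> \<delta> * norm y))"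
    if \<delta>: "0 < \<delta>" for \<delta>
  proof -
    obtain d where d: "0 < d"
      "\<And>h. norm h < d \<Longrightarrow> \<bar>norm (y0 + h) - 1 - D h\<bar> \<le> \<delta> / 2 * norm h"
      using approx[of "\<delta> / 2"] \<delta> by auto
    define r where "r = d / 2"
    have r: "0 < r" "r < d" using d(1) by (simp_all add: r_def)
    have main: "\<exists>c. norm c = 1 \<and> (\<forall>y. norm (c * g y - g0 y) \<le> \<delta> * norm y)"
      if g: "g \<in> dual_ball t" "1 - \<delta> / 2 * r < norm (g y0)" for g
    proof -
      obtain c where c: "norm c = 1" "c * g y0 = of_real (norm (g y0))"
        by (rule unimodular_rotation)
      have "norm (c * g y - g0 y) \<le> \<delta> * norm y" for y
      proof (cases "y = 0")
        case True
        then show ?thesis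
          using dual_ball_zero_point[OF g(1)] dual_ball_zero_point[OF g0(1)] by simp
      next
        case False
        obtain a where a: "norm a = 1"
          "a * (c * g y - g0 y) = of_real (norm (c * g y - g0 y))"
          by (rule unimodular_rotation)
        \<comment> \<open>The vector along \<open>y\<close> of length \<open>r\<close>, rotated so that \<open>c * g h - g0 h\<close> is a nonnegative real.\<close>
        define h where "h = (r / norm y) *\<^sub>R t a y"
        have h: "norm h = r"
          using False r(1) a(1) by (simp add: h_def S.norm_scale)
        have "c * g h - g0 h = of_real (r / norm y) * (a * (c * g y - g0 y))"
          by (simp add: h_def dual_ball_scaleR[OF g(1)] dual_ball_scaleR[OF g0(1)]
              dual_ball_scale[OF g(1)] dual_ball_scale[OF g0(1)] algebra_simps)
        also have "\<dots> = of_real (r / norm y * norm (c * g y - g0 y))"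
          by (simp add: a(2))
        finally have "r / norm y * norm (c * g y - g0 y) = real_part (c * g h - g0 h)"
          by (simp only: real_part_of_real)
        also have "\<dots> = real_part (c * g h) - D h"
          using bounded_linear.linear[OF bounded_linear_real_part, THEN linear_diff]
          by (metis g0(2))
        also have "real_part (c * g h) = real_part (c * g (y0 + h)) - norm (g y0)"
          using bounded_linear.linear[OF bounded_linear_real_part, THEN linear_add,
              of "c * g y0" "c * g h"]
          by (simp add: dual_ball_add[OF g(1)] distrib_left c(2) real_part_of_real)
        also have "real_part (c * g (y0 + h)) \<le> norm (c * g (y0 + h))"
          using abs_real_part_le_norm[of "c * g (y0 + h)"] by simp
        also have "\<dots> \<le> norm (y0 + h)"
          using dual_ball_norm[OF g(1), of "y0 + h"] c(1) by (simp add: norm_mult)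
        also have "\<dots> \<le> 1 + D h + \<delta> / 2 * r"
          using abs_le_D1[OF d(2)[of h]] h r(2) by simp
        finally have "r / norm y * norm (c * g y - g0 y) \<le> r * \<delta>"
          using g(2) by (simp add: algebra_simps)
        then show ?thesis using r(1) False by (simp add: field_simps)
      qed
      with c(1) show ?thesis by blast
    qed
    show ?thesis
      using main \<delta> r(1) by (intro exI[of _ "\<delta> / 2 * r"]) simp
  qed
  with g0(1) g0_y0 show thesis by (rule that)
qed

section \<open>The injective norm\<close>

lemma tensor_productE:
  assumes "u \<in> tensor_product s t"
  obtains n :: nat and x y where "u = (\<lambda>B. \<Sum>i<n. elem_tensor s t (x i) (y i) B)"
  using assms by (auto simp: tensor_product_def)

lemma elem_tensor_apply:
  "f \<in> dual_ball s \<Longrightarrow> g \<in> dual_ball t \<Longrightarrow> elem_tensor s t x y (\<lambda>x y. f x * g y) = f x * g y"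
  by (simp add: elem_tensor_def bilinear_form_dual)

lemma elem_tensor_in_tensor_product: "elem_tensor s t x y \<in> tensor_product s t"
  unfolding tensor_product_def
  by (auto intro!: exI[of _ "1::nat"] exI[of _ "\<lambda>_. x"] exI[of _ "\<lambda>_. y"])

lemma tensor_product_add:
  assumes "u \<in> tensor_product s t" "v \<in> tensor_product s t"
  shows "(\<lambda>B. u B + v B) \<in> tensor_product s t"
proof -
  obtain n :: nat and x y where u: "u = (\<lambda>B. \<Sum>i<n. elem_tensor s t (x i) (y i) B)"
    using assms(1) by (rule tensor_productE)
  obtain m :: nat and x' y' where v: "v = (\<lambda>B. \<Sum>i<m. elem_tensor s t (x' i) (y' i) B)"
    using assms(2) by (rule tensor_productE)
  define X where "X i = (if i < n then x i else x' (i - n))" for i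
  define Y where "Y i = (if i < n then y i else y' (i - n))" for i
  have "u B + v B = (\<Sum>i<n+m. elem_tensor s t (X i) (Y i) B)" for B
  proof -
    have "(\<Sum>i<n+m. elem_tensor s t (X i) (Y i) B)
      = (\<Sum>i<n. elem_tensor s t (X i) (Y i) B) + (\<Sum>i<m. elem_tensor s t (X (n+i)) (Y (n+i)) B)"
      by (induction m) (simp_all add: add.assoc)
    then show ?thesis by (simp add: u v X_def Y_def)
  qed
  then show ?thesis by (auto simp: tensor_product_def)
qed

lemma tensor_product_scale:
  assumes "u \<in> tensor_product s t"
  shows "(\<lambda>B. c * u B) \<in> tensor_product s t"
proof -
  obtain n :: nat and x y where u: "u = (\<lambda>B. \<Sum>i<n. elem_tensor s t (x i) (y i) B)"
    using assms by (rule tensor_productE)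
  have "c * elem_tensor s t a b B = elem_tensor s t (s c a) b B" for a b B
    by (auto simp: elem_tensor_def bilinear_form_def Vector_Spaces.linear_iff)
  then have "(\<lambda>B. c * u B) = (\<lambda>B. \<Sum>i<n. elem_tensor s t (s c (x i)) (y i) B)"
    by (simp add: u sum_distrib_left)
  then show ?thesis
    unfolding tensor_product_def by (intro CollectI exI conjI TrueI)
qed

lemma zero_in_dual_ball: "banach_space s \<Longrightarrow> (\<lambda>x. 0) \<in> dual_ball s"
  by (rule dual_ballI) simp_all

lemma norm_le_injective_norm:
  assumes u: "u \<in> tensor_product s t" and f: "f \<in> dual_ball s" and g: "g \<in> dual_ball t"
  shows "norm (u (\<lambda>x y. f x * g y)) \<le> injective_norm s t u"
proof -
  obtain n :: nat and x y where u: "u = (\<lambda>B. \<Sum>i<n. elem_tensor s t (x i) (y i) B)"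
    using u by (rule tensor_productE)
  have bound: "norm (u (\<lambda>x y. f x * g y)) \<le> (\<Sum>i<n. norm (x i) * norm (y i))"
    if "f \<in> dual_ball s" "g \<in> dual_ball t" for f g
    unfolding u elem_tensor_apply[OF that]
    by (rule sum_norm_le) (auto simp: norm_mult intro!: mult_mono dual_ball_norm that)
  have "bdd_above ((\<lambda>(f, g). norm (u (\<lambda>x y. f x * g y))) ` (dual_ball s \<times> dual_ball t))"
    by (rule bdd_aboveI2[where M = "\<Sum>i<n. norm (x i) * norm (y i)"]) (auto intro: bound)
  from cSUP_upper[OF _ this, of "(f, g)"] show ?thesis
    using f g by (simp add: injective_norm_def)
qed

lemma injective_norm_le:
  assumes "banach_space s" "banach_space t"
    and "\<And>f g. f \<in> dual_ball s \<Longrightarrow> g \<in> dual_ball t \<Longrightarrow> norm (u (\<lambda>x y. f x * g y)) \<le> M"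
  shows "injective_norm s t u \<le> M"
  unfolding injective_norm_def
proof (rule cSUP_least)
  show "dual_ball s \<times> dual_ball t \<noteq> {}"
    using zero_in_dual_ball[OF assms(1)] zero_in_dual_ball[OF assms(2)] by auto
qed (use assms(3) in auto)

lemma injective_norm_elem_tensor:
  assumes "banach_space s" "banach_space t"
  shows "injective_norm s t (elem_tensor s t x y) = norm x * norm y"
proof (rule antisym)
  show "injective_norm s t (elem_tensor s t x y) \<le> norm x * norm y"
    by (rule injective_norm_le[OF assms])
      (auto simp: elem_tensor_apply norm_mult intro!: mult_mono dual_ball_norm)
  obtain f where f: "f \<in> dual_ball s" "f x = of_real (norm x)"
    by (rule norming_functional[OF assms(1)])
  obtain g where g: "g \<in> dual_ball t" "g y = of_real (norm y)"
    by (rule norming_functional[OF assms(2)])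
  show "norm x * norm y \<le> injective_norm s t (elem_tensor s t x y)"
    using norm_le_injective_norm[OF elem_tensor_in_tensor_product f(1) g(1), of x y]
    by (simp add: elem_tensor_apply f g norm_mult)
qed

text \<open>The vector \<open>x = (id \<otimes> g) u\<close>.  A norming functional of \<open>x\<close> bounds its norm by that of \<open>u\<close>.\<close>

lemma tensor_slice:
  assumes "banach_space s" and u: "u \<in> tensor_product s t" and g: "g \<in> dual_ball t"
  obtains x where "norm x \<le> injective_norm s t u"
    "\<And>f. f \<in> dual_ball s \<Longrightarrow> f x = u (\<lambda>x y. f x * g y)"
proof -
  obtain n :: nat and x y where u': "u = (\<lambda>B. \<Sum>i<n. elem_tensor s t (x i) (y i) B)"
    using u by (rule tensor_productE)
  define z where "z = (\<Sum>i<n. s (g (y i)) (x i))"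
  have f_z: "f z = u (\<lambda>x y. f x * g y)" if f: "f \<in> dual_ball s" for f
    by (simp add: z_def u' dual_ball_sum[OF f] dual_ball_scale[OF f] elem_tensor_apply[OF f g]
        mult.commute)
  obtain f where f: "f \<in> dual_ball s" "f z = of_real (norm z)"
    by (rule norming_functional[OF assms(1)])
  have "norm z = norm (f z)" by (simp add: f(2))
  also have "\<dots> \<le> injective_norm s t u"
    unfolding f_z[OF f(1)] by (rule norm_le_injective_norm[OF u f(1) g])
  finally show thesis using f_z by (rule that)
qed

text \<open>Divided by \<open>\<delta>\<close>, the functional \<open>c g - h\<close> lies in the dual ball, so the definition of the
  injective norm applies to it.\<close>

lemma injective_norm_perturb:
  assumes "banach_space t" and u: "u \<in> tensor_product s t" and f: "f \<in> dual_ball s"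
    and g: "g \<in> dual_ball t" and h: "h \<in> dual_ball t"
    and \<delta>: "0 < \<delta>" and close: "\<And>y. norm (c * g y - h y) \<le> \<delta> * norm y"
  shows "norm (c * u (\<lambda>x y. f x * g y) - u (\<lambda>x y. f x * h y)) \<le> \<delta> * injective_norm s t u"
proof -
  obtain n :: nat and x y where u': "u = (\<lambda>B. \<Sum>i<n. elem_tensor s t (x i) (y i) B)"
    using u by (rule tensor_productE)
  define k where "k y = (c * g y - h y) / of_real \<delta>" for y
  have k: "k \<in> dual_ball t"
  proof (rule dual_ballI[OF assms(1)])
    show "norm (k y) \<le> norm y" for y
      using close[of y] \<delta> by (simp add: k_def norm_divide field_simps)
  qed (simp_all add: k_def dual_ball_add[OF g] dual_ball_add[OF h] dual_ball_scale[OF g]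
      dual_ball_scale[OF h] algebra_simps diff_divide_distrib add_divide_distrib)
  have k_eq: "of_real \<delta> * (a * k b) = c * (a * g b) - a * h b" for a b
    using \<delta> by (simp add: k_def field_simps)
  have "c * u (\<lambda>x y. f x * g y) - u (\<lambda>x y. f x * h y) = of_real \<delta> * u (\<lambda>x y. f x * k y)"
    unfolding u' elem_tensor_apply[OF f g] elem_tensor_apply[OF f h] elem_tensor_apply[OF f k]
    by (simp add: sum_distrib_left k_eq flip: sum_subtractf)
  then show ?thesis
    using norm_le_injective_norm[OF u f k] \<delta> by (simp add: norm_mult)
qed

section \<open>Functionals on a completion\<close>

text \<open>A functional bounded by \<open>N\<close> is Lipschitz with respect to the embedding; in particular it factors
  through \<open>\<iota>\<close>, which may fail to be injective when \<open>N\<close> is only a seminorm.  Its uniformly continuous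
  extension inherits linearity and the bound by taking limits along sequences from \<open>V\<close>.\<close>

lemma completion_extend_functional:
  fixes \<iota> :: "('i \<Rightarrow> 'k::real_or_complex) \<Rightarrow> 'z::banach"
  assumes compl: "is_completion V N sZ \<iota>"
    and V_add: "\<And>u v. u \<in> V \<Longrightarrow> v \<in> V \<Longrightarrow> (\<lambda>i. u i + v i) \<in> V"
    and V_scale: "\<And>c u. u \<in> V \<Longrightarrow> (\<lambda>i. c * u i) \<in> V"
    and L_add: "\<And>u v. u \<in> V \<Longrightarrow> v \<in> V \<Longrightarrow> L (\<lambda>i. u i + v i) = L u + L v"
    and L_scale: "\<And>c u. u \<in> V \<Longrightarrow> L (\<lambda>i. c * u i) = c * L u"
    and L_bound: "\<And>u. u \<in> V \<Longrightarrow> norm (L u) \<le> N u"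
  obtains F where "F \<in> dual_ball sZ" "\<And>u. u \<in> V \<Longrightarrow> F (\<iota> u) = L u"
proof -
  interpret Z: banach_space sZ using compl by (simp add: is_completion_def)
  have \<iota>_add: "\<iota> (\<lambda>i. u i + v i) = \<iota> u + \<iota> v" if "u \<in> V" "v \<in> V" for u v
    using compl that by (simp add: is_completion_def)
  have \<iota>_scale: "\<iota> (\<lambda>i. c * u i) = sZ c (\<iota> u)" if "u \<in> V" for c u
    using compl that by (simp add: is_completion_def)
  have L_dist: "dist (L u) (L v) \<le> dist (\<iota> u) (\<iota> v)" if "u \<in> V" "v \<in> V" for u v
  proof -
    define w where "w = (\<lambda>i. u i + (- 1) * v i)"
    have w: "w \<in> V" unfolding w_def by (intro V_add V_scale that)
    have "\<iota> w = \<iota> u - \<iota> v" "L w = L u - L v"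
      unfolding w_def
      by (simp_all only: \<iota>_add \<iota>_scale L_add L_scale V_scale that) simp_all
    moreover have "norm (\<iota> w) = N w" using compl w by (simp add: is_completion_def)
    ultimately show ?thesis using L_bound[OF w] by (simp add: dist_norm)
  qed
  define F0 where "F0 z = L (SOME u. u \<in> V \<and> \<iota> u = z)" for z
  have F0: "F0 (\<iota> u) = L u" if "u \<in> V" for u
  proof -
    have "(SOME v. v \<in> V \<and> \<iota> v = \<iota> u) \<in> V \<and> \<iota> (SOME v. v \<in> V \<and> \<iota> v = \<iota> u) = \<iota> u"
      by (rule someI[of _ u]) (use that in simp)
    then show ?thesis using L_dist[OF _ that] by (fastforce simp: F0_def)
  qed
  have uc: "uniformly_continuous_on (\<iota> ` V) F0"
    unfolding uniformly_continuous_on_def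
  proof (intro allI impI)
    fix e :: real assume "0 < e"
    moreover have "dist (F0 w) (F0 z) < e" if "z \<in> \<iota> ` V" "w \<in> \<iota> ` V" "dist w z < e" for z w
    proof -
      from that(1,2) obtain u v where uv: "u \<in> V" "v \<in> V" "z = \<iota> u" "w = \<iota> v"
        by blast
      then show ?thesis
        using L_dist[OF uv(2,1)] that(3) by (simp add: F0)
    qed
    ultimately show "\<exists>d>0. \<forall>z\<in>\<iota> ` V. \<forall>w\<in>\<iota> ` V. dist w z < d \<longrightarrow> dist (F0 w) (F0 z) < e"
      by blast
  qed
  obtain F where "uniformly_continuous_on (closure (\<iota> ` V)) F"
    and F_F0: "\<And>z. z \<in> \<iota> ` V \<Longrightarrow> F0 z = F z"
    using uniformly_continuous_on_extension_on_closure[OF uc] by metis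
  moreover have dense: "closure (\<iota> ` V) = UNIV" using compl by (simp add: is_completion_def)
  ultimately have cont: "isCont F z" for z
    by (simp add: isUCont_isCont)
  have F: "F (\<iota> u) = L u" if "u \<in> V" for u
    using F_F0[of "\<iota> u"] F0 that by simp
  have approx: "\<exists>u. (\<forall>n. u n \<in> V) \<and> (\<lambda>n. \<iota> (u n)) \<longlonglongrightarrow> z \<and> (\<lambda>n. L (u n)) \<longlonglongrightarrow> F z" for z
  proof -
    have "z \<in> closure (\<iota> ` V)" using dense by simp
    then obtain w where w: "\<And>n. w n \<in> \<iota> ` V" "w \<longlonglongrightarrow> z"
      by (auto simp: closure_sequential)
    have "\<forall>n. \<exists>u. u \<in> V \<and> w n = \<iota> u" using w(1) by blast
    from choice[OF this] obtain u where u: "\<And>n. u n \<in> V" "\<And>n. w n = \<iota> (u n)"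
      by blast
    have lim: "(\<lambda>n. \<iota> (u n)) \<longlonglongrightarrow> z"
      using w(2) by (simp flip: u(2))
    then have "(\<lambda>n. F (\<iota> (u n))) \<longlonglongrightarrow> F z"
      by (rule isCont_tendsto_compose[OF cont])
    then have "(\<lambda>n. L (u n)) \<longlonglongrightarrow> F z" by (simp add: F u)
    with u(1) lim show ?thesis by blast
  qed
  have "F \<in> dual_ball sZ"
  proof (rule dual_ballI[OF Z.banach_space_axioms])
    fix z w
    obtain u where u: "\<And>n. u n \<in> V" "(\<lambda>n. \<iota> (u n)) \<longlonglongrightarrow> z" "(\<lambda>n. L (u n)) \<longlonglongrightarrow> F z"
      using approx[of z] by blast
    obtain v where v: "\<And>n. v n \<in> V" "(\<lambda>n. \<iota> (v n)) \<longlonglongrightarrow> w" "(\<lambda>n. L (v n)) \<longlonglongrightarrow> F w"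
      using approx[of w] by blast
    have "(\<lambda>n. F (\<iota> (u n) + \<iota> (v n))) \<longlonglongrightarrow> F (z + w)"
      by (intro isCont_tendsto_compose[OF cont] tendsto_add u v)
    moreover have "F (\<iota> (u n) + \<iota> (v n)) = L (u n) + L (v n)" for n
      using u(1) v(1) by (simp add: F V_add L_add flip: \<iota>_add)
    moreover have "(\<lambda>n. L (u n) + L (v n)) \<longlonglongrightarrow> F z + F w"
      by (intro tendsto_add u v)
    ultimately show "F (z + w) = F z + F w"
      by (simp add: LIMSEQ_unique)
  next
    fix c z
    obtain u where u: "\<And>n. u n \<in> V" "(\<lambda>n. \<iota> (u n)) \<longlonglongrightarrow> z" "(\<lambda>n. L (u n)) \<longlonglongrightarrow> F z"
      using approx[of z] by blast
    have "(\<lambda>n. F (sZ c (\<iota> (u n)))) \<longlonglongrightarrow> F (sZ c z)"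
      by (intro isCont_tendsto_compose[OF cont] bounded_linear.tendsto[OF Z.bounded_linear_scale] u)
    moreover have "F (sZ c (\<iota> (u n))) = c * L (u n)" for n
      using u(1) by (simp add: F V_scale L_scale flip: \<iota>_scale)
    moreover have "(\<lambda>n. c * L (u n)) \<longlonglongrightarrow> c * F z"
      by (intro tendsto_intros u)
    ultimately show "F (sZ c z) = c * F z"
      by (simp add: LIMSEQ_unique)
  next
    fix z
    obtain u where u: "\<And>n. u n \<in> V" "(\<lambda>n. \<iota> (u n)) \<longlonglongrightarrow> z" "(\<lambda>n. L (u n)) \<longlonglongrightarrow> F z"
      using approx[of z] by blast
    have "norm (L (u n)) \<le> norm (\<iota> (u n))" for n
      using u(1) L_bound compl by (simp add: is_completion_def)
    then show "norm (F z) \<le> norm z"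
      by (intro tendsto_le[OF _ tendsto_norm[OF u(2)] tendsto_norm[OF u(3)]]) simp_all
  qed
  from this F show thesis by (rule that)
qed

section \<open>Rank-one operators and the Daugavet property\<close>

text \<open>The whole norm of \<open>T\<close> is put into the vector \<open>x0\<close>, so that the functional lies in the dual ball
  and can enter the injective norm directly.\<close>

lemma rank_one_operatorE:
  fixes s :: "'k::real_or_complex \<Rightarrow> 'a::banach \<Rightarrow> 'a"
  assumes "banach_space s" and T: "bounded_operator s s T"
    and dim: "vector_space.dim s (range T) = 1"
  obtains f x0 where "f \<in> dual_ball s" "norm x0 = onorm T" "0 < onorm T"
    "\<And>x. T x = s (f x) x0"
proof -
  interpret S: banach_space s by fact
  have bl: "bounded_linear T" and lin: "Vector_Spaces.linear s s T"
    using T by (auto simp: bounded_operator_def)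
  interpret T: Vector_Spaces.linear s s T by fact
  obtain B where B: "B \<subseteq> range T" "S.independent B" "range T \<subseteq> S.span B" "card B = 1"
    using S.basis_exists[of "range T"] dim by metis
  obtain b where b: "B = {b}" using B(4) by (rule card_1_singletonE)
  have "b \<noteq> 0" using B(2) b S.dependent_zero by blast
  have "\<not> (\<forall>x. T x = 0)" using B(1) b \<open>b \<noteq> 0\<close> by force
  then have pos: "0 < onorm T" by (simp add: onorm_pos_lt[OF bl])
  define x0 where "x0 = (onorm T / norm b) *\<^sub>R b"
  have x0: "norm x0 = onorm T" using \<open>b \<noteq> 0\<close> pos by (simp add: x0_def)
  then have "x0 \<noteq> 0" using pos by auto
  have "\<exists>c. T x = s c x0" for x
  proof -
    have "T x \<in> S.span {b}" using B(3) b by blast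
    then obtain c where "T x = s c b" by (auto simp: S.span_singleton)
    also have "b = s (of_real (norm b / onorm T)) x0"
      using \<open>b \<noteq> 0\<close> pos by (simp add: x0_def S.scale_of_real flip: of_real_divide)
    finally show ?thesis by auto
  qed
  then obtain f where f: "\<And>x. T x = s (f x) x0" by metis
  have inj: "c = d" if "s c x0 = s d x0" for c d
    using that \<open>x0 \<noteq> 0\<close> by simp
  have "f \<in> dual_ball s"
  proof (rule dual_ballI[OF assms(1)])
    show "f (x + y) = f x + f y" for x y
      by (rule inj) (simp add: S.scale_left_distrib T.add flip: f)
    show "f (s c x) = c * f x" for c x
      by (rule inj) (simp add: T.scale flip: f S.scale_scale)
    fix x
    have "norm (f x) * onorm T = norm (T x)"
      by (simp add: f S.norm_scale x0)
    also have "\<dots> \<le> onorm T * norm x" by (rule onorm[OF bl])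
    finally show "norm (f x) \<le> norm x" using pos by simp
  qed
  with x0 pos f show thesis using that by blast
qed

lemma rank_one_operator:
  assumes "banach_space s" "F \<in> dual_ball s" "F z \<noteq> 0" "e \<noteq> 0"
  shows "bounded_operator s s (\<lambda>x. s (F x) e)"
    and "vector_space.dim s (range (\<lambda>x. s (F x) e)) = 1"
proof -
  interpret S: banach_space s by fact
  show "bounded_operator s s (\<lambda>x. s (F x) e)"
  proof (rule bounded_operatorI[OF assms(1,1)])
    show "norm (s (F x) e) \<le> norm e * norm x" for x
      using mult_right_mono[OF dual_ball_norm[OF assms(2), of x], of "norm e"]
      by (simp add: S.norm_scale mult.commute)
  qed (simp_all add: dual_ball_add[OF assms(2)] dual_ball_scale[OF assms(2)]
      S.scale_left_distrib)
  have "e = s (F (s (1 / F z) z)) e"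
    using assms(3) by (simp add: dual_ball_scale[OF assms(2)])
  then have "{e} \<subseteq> range (\<lambda>x. s (F x) e)" by blast
  moreover have "range (\<lambda>x. s (F x) e) \<subseteq> S.span {e}"
    by (auto simp: S.span_singleton)
  moreover have "S.independent {e}" using assms(4) by simp
  ultimately show "S.dim (range (\<lambda>x. s (F x) e)) = 1"
    by (rule S.dim_unique) simp
qed

lemma onorm_id_plus_le:
  fixes T :: "'a::real_normed_vector \<Rightarrow> 'a"
  assumes "bounded_linear T"
  shows "onorm (\<lambda>x. x + T x) \<le> 1 + onorm T"
  using onorm_triangle[OF bounded_linear_ident assms] onorm_id_le[where 'a = 'a]
  by simp

lemma onorm_le_dense:
  assumes T: "bounded_linear T" and "closure A = UNIV" "0 \<le> M"
    and bound: "\<And>z. z \<in> A \<Longrightarrow> norm (T z) \<le> M * norm z"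
  shows "onorm T \<le> M"
proof (rule onorm_bound[OF assms(3)])
  fix z
  have "closed {z. norm (T z) \<le> M * norm z}"
    by (intro closed_Collect_le continuous_intros
        bounded_linear.continuous_on[OF T])
  then have "closure A \<subseteq> {z. norm (T z) \<le> M * norm z}"
    using bound by (intro closure_minimal) auto
  with assms(2) show "norm (T z) \<le> M * norm z" by auto
qed

theorem proposition4p3:
  fixes sX :: "'k::real_or_complex \<Rightarrow> 'a::banach \<Rightarrow> 'a"
    and sY :: "'k \<Rightarrow> 'b::banach \<Rightarrow> 'b"
    and sZ :: "'k \<Rightarrow> 'z::banach \<Rightarrow> 'z"
    and \<iota> :: "('a, 'b, 'k) tensor \<Rightarrow> 'z"
    and y0 :: 'b
  assumes "banach_space sX" and "banach_space sY"
    and "injective_tensor_product sX sY sZ \<iota>"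
    and "daugavet_property sZ"
    and "norm y0 = 1"
    and "(norm :: 'b \<Rightarrow> real) differentiable (at y0)"
  shows "daugavet_property sX"
  unfolding daugavet_property_def
proof (intro allI impI, elim conjE)
  fix T assume T: "bounded_operator sX sX T" and dim: "vector_space.dim sX (range T) = 1"
  interpret X: banach_space sX by fact
  let ?V = "tensor_product sX sY"
  let ?N = "injective_norm sX sY"
  have compl: "is_completion ?V ?N sZ \<iota>"
    using assms(3) by (simp add: injective_tensor_product_def)
  interpret Z: banach_space sZ using compl by (simp add: is_completion_def)
  have \<iota>_add: "\<iota> (\<lambda>B. u B + v B) = \<iota> u + \<iota> v" if "u \<in> ?V" "v \<in> ?V" for u v
    using compl that by (simp add: is_completion_def)
  have \<iota>_scale: "\<iota> (\<lambda>B. c * u B) = sZ c (\<iota> u)" if "u \<in> ?V" for c u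
    using compl that by (simp add: is_completion_def)
  have \<iota>_norm: "norm (\<iota> u) = ?N u" if "u \<in> ?V" for u
    using compl that by (simp add: is_completion_def)
  have blT: "bounded_linear T" using T by (simp add: bounded_operator_def)
  obtain f x0 where f: "f \<in> dual_ball sX" and x0: "norm x0 = onorm T" and pos: "0 < onorm T"
    and T_eq: "\<And>x. T x = sX (f x) x0"
    using rank_one_operatorE[OF assms(1) T dim] by metis
  obtain g0 where g0: "g0 \<in> dual_ball sY" "g0 y0 = 1"
    and smulyan: "\<And>\<delta>. 0 < \<delta> \<Longrightarrow> \<exists>\<eta>>0. \<forall>g\<in>dual_ball sY. 1 - \<eta> < norm (g y0) \<longrightarrow>
        (\<exists>c. norm c = 1 \<and> (\<forall>y. norm (c * g y - g0 y) \<le> \<delta> * norm y))"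
    using smulyan[OF assms(2,5,6)] by metis
  define L where "L u = u (\<lambda>x y. f x * g0 y)" for u :: "('a, 'b, 'k) tensor"
  obtain F where F: "F \<in> dual_ball sZ" "\<And>u. u \<in> ?V \<Longrightarrow> F (\<iota> u) = L u"
    using completion_extend_functional[OF compl tensor_product_add tensor_product_scale, of L]
      norm_le_injective_norm[OF _ f g0(1)]
    unfolding L_def by metis
  have L_bound: "norm (L u) \<le> ?N u" if "u \<in> ?V" for u
    unfolding L_def by (rule norm_le_injective_norm[OF that f g0(1)])
  define e where "e = elem_tensor sX sY x0 y0"
  have e: "e \<in> ?V" unfolding e_def by (rule elem_tensor_in_tensor_product)
  have N_elem: "?N (elem_tensor sX sY x y0) = norm x" for x
    by (simp add: injective_norm_elem_tensor[OF assms(1,2)] assms(5))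
  \<comment> \<open>The operator \<open>S = (f \<otimes> g0) \<otimes> (x0 \<otimes> y0)\<close> on the tensor product, of norm at least that of \<open>T\<close>.\<close>
  define S where "S z = sZ (F z) (\<iota> e)" for z
  have S_elem: "norm (S (\<iota> (elem_tensor sX sY x y0))) = norm (T x)" for x
    by (simp add: S_def F(2) L_def elem_tensor_in_tensor_product elem_tensor_apply[OF f g0(1)] g0(2)
        Z.norm_scale X.norm_scale T_eq \<iota>_norm[OF e] N_elem[of x0, folded e_def])
  obtain x1 where "T x1 \<noteq> 0" using pos by (auto simp: onorm_pos_lt[OF blT])
  then have S_ne: "S (\<iota> (elem_tensor sX sY x1 y0)) \<noteq> 0"
    using S_elem[of x1] by force
  have F_ne: "F (\<iota> (elem_tensor sX sY x1 y0)) \<noteq> 0" and e_ne: "\<iota> e \<noteq> 0"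
    using S_ne by (auto simp: S_def)
  have S: "bounded_operator sZ sZ S" "vector_space.dim sZ (range S) = 1"
    using rank_one_operator[OF Z.banach_space_axioms F(1) F_ne e_ne] by (simp_all add: S_def[abs_def])
  then have blS: "bounded_linear S" by (simp add: bounded_operator_def)
  have "onorm T \<le> onorm S"
  proof (rule onorm_bound[OF onorm_pos_le[OF blS]])
    fix x
    show "norm (T x) \<le> onorm S * norm x"
      using onorm[OF blS, of "\<iota> (elem_tensor sX sY x y0)"]
      by (simp add: S_elem \<iota>_norm elem_tensor_in_tensor_product N_elem)
  qed
  also have "1 + onorm S = onorm (\<lambda>z. z + S z)"
    using assms(4) S by (simp add: daugavet_property_def)
  finally have lower: "1 + onorm T \<le> onorm (\<lambda>z. z + S z)" by simp

  define K where "K = onorm (\<lambda>x. x + T x)"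
  have blK: "bounded_linear (\<lambda>x. x + T x)" by (intro bounded_linear_add bounded_linear_ident blT)
  have K0: "0 \<le> K" unfolding K_def by (rule onorm_pos_le[OF blK])
  have upper: "1 + onorm T \<le> K + \<delta> * (1 + onorm T)" if \<delta>: "0 < \<delta>" for \<delta>
  proof -
    obtain \<eta> where \<eta>: "0 < \<eta>" and near: "\<And>g. g \<in> dual_ball sY \<Longrightarrow> 1 - \<eta> < norm (g y0) \<Longrightarrow>
        \<exists>c. norm c = 1 \<and> (\<forall>y. norm (c * g y - g0 y) \<le> \<delta> * norm y)"
      using smulyan[OF \<delta>] by metis
    \<comment> \<open>The first bound is for functionals \<open>g\<close> far from norming \<open>y0\<close>, the second for those close to it.\<close>
    define M where "M = max (1 + onorm T * (1 - \<eta>)) (K + \<delta> * (1 + onorm T))"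
    have M0: "0 \<le> M"
      using K0 \<delta> pos by (simp add: M_def le_max_iff_disj)
    have "onorm (\<lambda>z. z + S z) \<le> M"
    proof (rule onorm_le_dense[OF _ _ M0])
      show "bounded_linear (\<lambda>z. z + S z)" by (intro bounded_linear_add bounded_linear_ident blS)
      show "closure (\<iota> ` ?V) = UNIV" using compl by (simp add: is_completion_def)
      fix z assume "z \<in> \<iota> ` ?V"
      then obtain u where u: "u \<in> ?V" and z: "z = \<iota> u" by blast
      define w where "w = (\<lambda>B. u B + L u * e B)"
      have w: "w \<in> ?V" unfolding w_def by (intro tensor_product_add tensor_product_scale u e)
      have w_eq: "\<iota> w = z + S z"
        unfolding w_def S_def z by (simp add: \<iota>_add \<iota>_scale u e tensor_product_scale F(2))
      have Nu: "0 \<le> ?N u" using \<iota>_norm[OF u] norm_ge_zero[of "\<iota> u"] by simp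
      have w_apply: "w (\<lambda>x y. h x * g y) = u (\<lambda>x y. h x * g y) + L u * (h x0 * g y0)"
        if "h \<in> dual_ball sX" "g \<in> dual_ball sY" for h g
        by (simp add: w_def e_def elem_tensor_apply[OF that])
      have Nw: "?N w \<le> (1 + onorm T) * ?N u"
      proof -
        have "?N w = norm (z + sZ (L u) (\<iota> e))"
          using \<iota>_norm[OF w] w_eq by (simp add: S_def z F(2)[OF u])
        also have "\<dots> \<le> norm z + norm (sZ (L u) (\<iota> e))" by (rule norm_triangle_ineq)
        also have "\<dots> = ?N u + norm (L u) * onorm T"
          by (simp add: z \<iota>_norm u e Z.norm_scale N_elem[of x0, folded e_def] x0)
        also have "\<dots> \<le> ?N u + ?N u * onorm T"
          using L_bound[OF u] pos by (simp add: mult_right_mono)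
        finally show ?thesis by (simp add: algebra_simps)
      qed
      have "?N w \<le> M * ?N u"
      proof (rule injective_norm_le[OF assms(1,2)])
        fix h g assume h: "h \<in> dual_ball sX" and g: "g \<in> dual_ball sY"
        show "norm (w (\<lambda>x y. h x * g y)) \<le> M * ?N u"
        proof (cases "1 - \<eta> < norm (g y0)")
          case False
          have "norm (w (\<lambda>x y. h x * g y))
              \<le> norm (u (\<lambda>x y. h x * g y)) + norm (L u) * (norm (h x0) * norm (g y0))"
            using norm_triangle_ineq[of "u (\<lambda>x y. h x * g y)" "L u * (h x0 * g y0)"]
            by (simp add: w_apply[OF h g] norm_mult)
          also have "\<dots> \<le> ?N u + ?N u * (onorm T * (1 - \<eta>))"
            using False dual_ball_norm[OF h, of x0] x0 pos Nu
            by (intro add_mono mult_mono norm_le_injective_norm u h g L_bound) auto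
          also have "\<dots> = (1 + onorm T * (1 - \<eta>)) * ?N u"
            by (simp add: algebra_simps)
          also have "\<dots> \<le> M * ?N u"
            using Nu by (intro mult_right_mono) (simp_all add: M_def)
          finally show ?thesis .
        next
          case True
          \<comment> \<open>Up to the rotation \<open>c\<close> and an error of order \<open>\<delta>\<close>, \<open>g\<close> acts as \<open>g0\<close>, which turns \<open>w\<close> into the vector \<open>x + T x\<close>.\<close>
          then obtain c where c: "norm c = 1" "\<And>y. norm (c * g y - g0 y) \<le> \<delta> * norm y"
            using near[OF g] by blast
          obtain x where x: "norm x \<le> ?N u"
            "\<And>h. h \<in> dual_ball sX \<Longrightarrow> h x = u (\<lambda>x y. h x * g0 y)"
            using tensor_slice[OF assms(1) u g0(1)] by metis
          have "w (\<lambda>x y. h x * g0 y) = h (x + T x)"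
            by (simp add: w_apply[OF h g0(1)] g0(2) L_def dual_ball_add[OF h]
                dual_ball_scale[OF h] T_eq flip: x(2)[OF f] x(2)[OF h])
          then have "norm (w (\<lambda>x y. h x * g0 y)) \<le> norm (x + T x)"
            using dual_ball_norm[OF h] by simp
          also have "\<dots> \<le> K * norm x"
            unfolding K_def by (rule onorm[OF blK])
          also have "\<dots> \<le> K * ?N u"
            by (rule mult_left_mono[OF x(1) K0])
          finally have slice: "norm (w (\<lambda>x y. h x * g0 y)) \<le> K * ?N u" .
          have "norm (c * w (\<lambda>x y. h x * g y) - w (\<lambda>x y. h x * g0 y)) \<le> \<delta> * ?N w"
            by (rule injective_norm_perturb[OF assms(2) w h g g0(1) \<delta> c(2)])
          also have "\<dots> \<le> \<delta> * ((1 + onorm T) * ?N u)"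
            using \<delta> Nw by (intro mult_left_mono) simp_all
          finally have "norm (c * w (\<lambda>x y. h x * g y)) \<le> (K + \<delta> * (1 + onorm T)) * ?N u"
            using slice norm_triangle_sub[of "c * w (\<lambda>x y. h x * g y)" "w (\<lambda>x y. h x * g0 y)"]
            by (simp add: algebra_simps)
          also have "\<dots> \<le> M * ?N u"
            using Nu by (intro mult_right_mono) (simp_all add: M_def)
          finally show ?thesis using c(1) by (simp add: norm_mult)
        qed
      qed
      then show "norm (z + S z) \<le> M * norm z"
        using \<iota>_norm[OF w] \<iota>_norm[OF u] w_eq z by simp
    qed
    with lower have "1 + onorm T \<le> M" by simp
    moreover have "onorm T * (1 - \<eta>) < onorm T" using pos \<eta> by (simp add: algebra_simps)
    ultimately show ?thesis by (simp add: M_def max_def split: if_splits)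
  qed
  have "1 + onorm T \<le> K"
  proof (rule field_le_epsilon)
    fix \<epsilon> :: real assume "0 < \<epsilon>"
    then show "1 + onorm T \<le> K + \<epsilon>"
      using upper[of "\<epsilon> / (1 + onorm T)"] pos by simp
  qed
  then show "onorm (\<lambda>x. x + T x) = 1 + onorm T"
    using onorm_id_plus_le[OF blT] by (simp add: K_def)
qed

end
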